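(* Finitely generated free groups are effectively conjugacy separable.
   Context: A group $G$ with a finite generating set $\mathcal S$ is effectively conjugacy separable if there is a computable function $\Phi:\mathbb{N}\to\mathbb{N}$ such that for any non-conjugate pair of elements $g,h\in G$ there is a finite quotient $Q_{g,h}$ of $G$ in which the images of $g$ and $h$ are not conjugate, with $|Q_{g,h}|\le \Phi(\ell_{\mathcal S}(g)+\ell_{\mathcal S}(h))$, where $\ell_{\mathcal S}$ denotes word length with respect to $\mathcal S$. *)

theory Defs
  imports "HOL-Algebra.Algebra"
begin

section \<open>Computable functions\<close>

text \<open>
  Computability is understood in the sense of partial recursive functions. Programs carry no
  arity annotation; the length of the argument list is checked only where a rule depends on it.
\<close>

datatype recf =
    Zero
  | Succ
  | Proj nat
  | Comp recf "recf list"
  | PrimRec recf recf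
  | Mu recf

text \<open>
  \<open>evaluates p xs y\<close>: program \<open>p\<close> halts on the argument list \<open>xs\<close> with result \<open>y\<close>. The recursion
  argument of \<open>PrimRec\<close> and the search variable of \<open>Mu\<close> come first in the argument list; an
  unbounded search halts at \<open>n\<close> only if the searched program halts with a nonzero value at every
  smaller argument.
\<close>

inductive evaluates :: "recf \<Rightarrow> nat list \<Rightarrow> nat \<Rightarrow> bool" where
  ev_Zero: "evaluates Zero xs 0"
| ev_Succ: "evaluates Succ [x] (Suc x)"
| ev_Proj: "i < length xs \<Longrightarrow> evaluates (Proj i) xs (xs ! i)"
| ev_Comp: "list_all2 (\<lambda>g y. evaluates g xs y) gs ys \<Longrightarrow> evaluates f ys z
    \<Longrightarrow> evaluates (Comp f gs) xs z"
| ev_PrimRec_0: "evaluates f xs z \<Longrightarrow> evaluates (PrimRec f g) (0 # xs) z"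
| ev_PrimRec_Suc: "evaluates (PrimRec f g) (n # xs) y \<Longrightarrow> evaluates g (n # y # xs) z
    \<Longrightarrow> evaluates (PrimRec f g) (Suc n # xs) z"
| ev_Mu: "evaluates f (n # xs) 0 \<Longrightarrow> (\<And>m. m < n \<Longrightarrow> \<exists>y. evaluates f (m # xs) (Suc y))
    \<Longrightarrow> evaluates (Mu f) xs n"

inductive_cases evaluates_ZeroE: "evaluates Zero xs z"
inductive_cases evaluates_SuccE: "evaluates Succ xs z"
inductive_cases evaluates_ProjE: "evaluates (Proj i) xs z"
inductive_cases evaluates_CompE: "evaluates (Comp f gs) xs z"
inductive_cases evaluates_PrimRec_0E: "evaluates (PrimRec f g) (0 # xs) z"
inductive_cases evaluates_PrimRec_SucE: "evaluates (PrimRec f g) (Suc n # xs) z"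
inductive_cases evaluates_MuE: "evaluates (Mu f) xs z"

lemma evaluates_deterministic:
  "evaluates p xs y \<Longrightarrow> evaluates p xs z \<Longrightarrow> y = z"
proof (induction arbitrary: z rule: evaluates.induct)
  case (ev_Zero xs)
  then show ?case by (blast elim: evaluates_ZeroE)
next
  case (ev_Succ x)
  then show ?case by (auto elim: evaluates_SuccE)
next
  case (ev_Proj i xs)
  then show ?case by (auto elim: evaluates_ProjE)
next
  case (ev_Comp xs gs ys f w)
  from ev_Comp.prems obtain ys' where
    ys': "list_all2 (\<lambda>g y. evaluates g xs y) gs ys'" "evaluates f ys' z"
    by (rule evaluates_CompE)
  have IH: "list_all2 (\<lambda>g y. \<forall>z. evaluates g xs z \<longrightarrow> y = z) gs ys"
    by (rule list_all2_mono[OF ev_Comp.IH(1)]) iprover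
  have "ys = ys'"
  proof (rule nth_equalityI)
    show "length ys = length ys'"
      by (simp only: list_all2_lengthD[OF IH, symmetric] list_all2_lengthD[OF ys'(1)])
    show "ys ! i = ys' ! i" if "i < length ys" for i
    proof -
      have i: "i < length gs" using that list_all2_lengthD[OF IH] by simp
      show ?thesis
        using list_all2_nthD[OF IH i] list_all2_nthD[OF ys'(1) i] by iprover
    qed
  qed
  then show ?case using ev_Comp.IH(2)[of z] ys'(2) by iprover
next
  case (ev_PrimRec_0 f xs w g)
  then show ?case by (blast elim: evaluates_PrimRec_0E)
next
  case (ev_PrimRec_Suc f g n xs y w)
  from ev_PrimRec_Suc.prems obtain y' where
    "evaluates (PrimRec f g) (n # xs) y'" "evaluates g (n # y' # xs) z"
    by (rule evaluates_PrimRec_SucE)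
  then show ?case using ev_PrimRec_Suc.IH by blast
next
  case (ev_Mu f n xs)
  from ev_Mu.prems have z: "evaluates f (z # xs) 0"
    by (rule evaluates_MuE)
  from ev_Mu.prems have less: "\<exists>y. evaluates f (m # xs) (Suc y)" if "m < z" for m
    using that by (elim evaluates_MuE) simp
  have "\<not> n < z" using less[of n] ev_Mu.IH(1) by fastforce
  moreover have "\<not> z < n" using z ev_Mu.IH(2)[of z] by fastforce
  ultimately show ?case by simp
qed

definition computable :: "(nat \<Rightarrow> nat) \<Rightarrow> bool" where
  "computable f \<longleftrightarrow> (\<exists>p. \<forall>n. evaluates p [n] (f n))"


section \<open>Free groups\<close>

text \<open>
  A word over \<open>B\<close> is a list of letters \<open>(x, e)\<close> with \<open>x \<in> B\<close>, where \<open>(x, True)\<close> stands for \<open>x\<close>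
  and \<open>(x, False)\<close> for its inverse.
\<close>

definition letter_value :: "('a, 'b) monoid_scheme \<Rightarrow> 'a \<times> bool \<Rightarrow> 'a" where
  "letter_value G l = (if snd l then fst l else inv\<^bsub>G\<^esub> (fst l))"

definition word_value :: "('a, 'b) monoid_scheme \<Rightarrow> ('a \<times> bool) list \<Rightarrow> 'a" where
  "word_value G w = foldr (\<lambda>l g. letter_value G l \<otimes>\<^bsub>G\<^esub> g) w \<one>\<^bsub>G\<^esub>"

definition reduced :: "('a \<times> bool) list \<Rightarrow> bool" where
  "reduced w \<longleftrightarrow> successively (\<lambda>l l'. \<not> (fst l = fst l' \<and> snd l \<noteq> snd l')) w"

definition reduced_words :: "'a set \<Rightarrow> ('a \<times> bool) list set" where
  "reduced_words B = {w. fst ` set w \<subseteq> B \<and> reduced w}"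

text \<open>
  \<open>B\<close> is a free basis of \<open>G\<close> if every element of \<open>G\<close> is the value of exactly one reduced word
  over \<open>B\<close>, i.e. evaluation identifies \<open>G\<close> with the group of reduced words over \<open>B\<close>.
\<close>

definition free_basis :: "('a, 'b) monoid_scheme \<Rightarrow> 'a set \<Rightarrow> bool" where
  "free_basis G B \<longleftrightarrow>
     B \<subseteq> carrier G \<and> bij_betw (word_value G) (reduced_words B) (carrier G)"

definition free_group :: "('a, 'b) monoid_scheme \<Rightarrow> bool" where
  "free_group G \<longleftrightarrow> group G \<and> (\<exists>B. free_basis G B)"


section \<open>Effective conjugacy separability\<close>

definition conjugate_in :: "('a, 'b) monoid_scheme \<Rightarrow> 'a \<Rightarrow> 'a \<Rightarrow> bool" where
  "conjugate_in G g h \<longleftrightarrow> (\<exists>x \<in> carrier G. h = x \<otimes>\<^bsub>G\<^esub> g \<otimes>\<^bsub>G\<^esub> inv\<^bsub>G\<^esub> x)"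

text \<open>
  The word length is meaningful only for elements of the subgroup generated by \<open>S\<close>; elsewhere
  the value of \<open>LEAST\<close> is unspecified.
\<close>

definition word_length :: "('a, 'b) monoid_scheme \<Rightarrow> 'a set \<Rightarrow> 'a \<Rightarrow> nat" where
  "word_length G S g =
     (LEAST n. \<exists>w. length w = n \<and> fst ` set w \<subseteq> S \<and> word_value G w = g)"

text \<open>
  Finite quotients of \<open>G\<close> are the groups \<open>G Mod N\<close> for normal subgroups \<open>N\<close> of finite index, and
  the coset \<open>N #> g\<close> is the image of \<open>g\<close>. Finiteness is required separately because \<open>order\<close> is
  \<open>0\<close> for infinite groups. The bound \<open>\<Phi>\<close> may depend on \<open>G\<close> and \<open>S\<close>, but not on \<open>g\<close> and \<open>h\<close>.
\<close>

definition effectively_conjugacy_separable ::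
    "('a, 'b) monoid_scheme \<Rightarrow> 'a set \<Rightarrow> bool" where
  "effectively_conjugacy_separable G S \<longleftrightarrow>
     (\<exists>\<Phi>. computable \<Phi> \<and>
       (\<forall>g \<in> carrier G. \<forall>h \<in> carrier G. \<not> conjugate_in G g h \<longrightarrow>
         (\<exists>N. N \<lhd> G \<and> finite (carrier (G Mod N)) \<and>
           \<not> conjugate_in (G Mod N) (N #>\<^bsub>G\<^esub> g) (N #>\<^bsub>G\<^esub> h) \<and>
           order (G Mod N) \<le> \<Phi> (word_length G S g + word_length G S h))))"

end

theory Submission
  imports Defs
begin

text \<open>
  Conjugate two given non-conjugate elements to the values of cyclically reduced words \<open>u\<close> and \<open>w\<close>
  over a free basis, with \<open>length w \<le> length u = n\<close>; here \<open>n > 0\<close>, as otherwise both would be trivial.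
  Place the letters of \<open>u\<close> around a directed cycle with vertices \<open>0, \<dots>, n - 1\<close>. As \<open>u\<close> is
  cyclically reduced, each basis element labels a partial injection of the vertex set, which extends
  to a permutation of it. Every edge of the cycle carries weight \<open>1\<close> in its forward direction and
  \<open>-1\<close> in its backward direction, and every edge added by the extension carries weight \<open>0\<close>. Letting
  a letter also shift a second coordinate, taken modulo \<open>2n + 1\<close>, by the weight of the edge along
  which it moves gives an action of the free group on \<open>n(2n + 1)\<close> points.

  The word \<open>u\<close> fixes the vertex \<open>0\<close> and shifts the second coordinate there by \<open>n\<close>. The action
  commutes with translations of the second coordinate, so if the image of \<open>w\<close> is conjugate to that of
  \<open>u\<close>, then \<open>w\<close> has total weight congruent to \<open>n\<close> modulo \<open>2n + 1\<close> from some vertex. Its total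
  weight is at most \<open>length w \<le> n\<close> in absolute value, hence equals \<open>n\<close>; so \<open>w\<close> has length \<open>n\<close> and each
  of its steps runs forward along the cycle (\<open>run_forward\<close>). Thus \<open>w\<close> is a rotation of \<open>u\<close>
  (\<open>cover_separates\<close>), which makes the two elements conjugate in the group itself, a contradiction.

  The image of the action is a finite quotient of order at most \<open>k ^ k\<close> with \<open>k = n(2n + 1)\<close>
  (\<open>quotient_separating\<close>). Since \<open>n\<close> is at most a constant times the word length with respect to the
  given finite generating set (\<open>rewrite_words_length\<close>), this bound is primitive recursive in the sum
  of the two word lengths. The action is defined through the universal property of free bases
  (\<open>free_basis_extend_hom\<close>), which follows from the invariance of word values under free reduction.
\<close>

section \<open>Primitive recursive arithmetic\<close>

text \<open>
  The first argument of \<open>add_prog\<close>, \<open>mult_prog\<close> and \<open>power_prog\<close> is the recursion argument; for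
  \<open>power_prog\<close> it is the exponent.
\<close>

fun const_prog :: "nat \<Rightarrow> recf" where
  "const_prog 0 = Zero"
| "const_prog (Suc k) = Comp Succ [const_prog k]"

definition add_prog :: recf where
  "add_prog = PrimRec (Proj 0) (Comp Succ [Proj 1])"

definition mult_prog :: recf where
  "mult_prog = PrimRec Zero (Comp add_prog [Proj 1, Proj 2])"

definition power_prog :: recf where
  "power_prog = PrimRec (const_prog 1) (Comp mult_prog [Proj 1, Proj 2])"

lemma evaluates_Proj: "i < length xs \<Longrightarrow> y = xs ! i \<Longrightarrow> evaluates (Proj i) xs y"
  by (simp add: ev_Proj)

lemma evaluates_Comp1: "evaluates g xs y \<Longrightarrow> evaluates f [y] z \<Longrightarrow> evaluates (Comp f [g]) xs z"
  by (rule ev_Comp[where ys = "[y]"]) simp_all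

lemma evaluates_Comp2:
  "evaluates g xs y \<Longrightarrow> evaluates g' xs y' \<Longrightarrow> evaluates f [y, y'] z \<Longrightarrow> evaluates (Comp f [g, g']) xs z"
  by (rule ev_Comp[where ys = "[y, y']"]) simp_all

lemma evaluates_const_prog: "evaluates (const_prog k) xs k"
  by (induction k) (auto intro: ev_Zero ev_Succ evaluates_Comp1)

lemma evaluates_add_prog: "evaluates add_prog [m, k] (m + k)"
proof (induction m)
  case 0
  then show ?case
    by (auto simp: add_prog_def intro!: ev_PrimRec_0 evaluates_Proj)
next
  case (Suc m)
  have "evaluates (Comp Succ [Proj 1]) [m, m + k, k] (Suc (m + k))"
    by (rule evaluates_Comp1[OF evaluates_Proj ev_Succ]) simp_all
  with Suc show ?case
    by (auto simp: add_prog_def intro: ev_PrimRec_Suc)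
qed

lemma evaluates_mult_prog: "evaluates mult_prog [m, k] (m * k)"
proof (induction m)
  case 0
  then show ?case
    by (auto simp: mult_prog_def intro!: ev_PrimRec_0 ev_Zero)
next
  case (Suc m)
  have "evaluates (Comp add_prog [Proj 1, Proj 2]) [m, m * k, k] (m * k + k)"
    by (rule evaluates_Comp2[OF evaluates_Proj evaluates_Proj evaluates_add_prog]) simp_all
  with Suc show ?case
    by (auto simp: mult_prog_def add.commute intro: ev_PrimRec_Suc)
qed

lemma evaluates_power_prog: "evaluates power_prog [m, k] (k ^ m)"
proof (induction m)
  case 0
  then show ?case
    using evaluates_const_prog[of 1 "[k]"] by (auto simp: power_prog_def intro!: ev_PrimRec_0)
next
  case (Suc m)
  have "evaluates (Comp mult_prog [Proj 1, Proj 2]) [m, k ^ m, k] (k ^ m * k)"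
    by (rule evaluates_Comp2[OF evaluates_Proj evaluates_Proj evaluates_mult_prog]) simp_all
  with Suc show ?case
    by (auto simp: power_prog_def mult.commute intro: ev_PrimRec_Suc)
qed

lemma computable_ident: "computable (\<lambda>n. n)"
  unfolding computable_def by (rule exI[of _ "Proj 0"]) (simp add: evaluates_Proj)

lemma computable_const: "computable (\<lambda>_. k)"
  unfolding computable_def by (rule exI[of _ "const_prog k"]) (simp add: evaluates_const_prog)

lemma computable_add: "computable f \<Longrightarrow> computable g \<Longrightarrow> computable (\<lambda>n. f n + g n)"
  unfolding computable_def by (blast intro: evaluates_Comp2 evaluates_add_prog)

lemma computable_mult: "computable f \<Longrightarrow> computable g \<Longrightarrow> computable (\<lambda>n. f n * g n)"
  unfolding computable_def by (blast intro: evaluates_Comp2 evaluates_mult_prog)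

lemma computable_power: "computable f \<Longrightarrow> computable g \<Longrightarrow> computable (\<lambda>n. f n ^ g n)"
  unfolding computable_def by (blast intro: evaluates_Comp2 evaluates_power_prog)


section \<open>Words and conjugacy in a group\<close>

text \<open>All words with letters from \<open>B\<close>, reduced or not.\<close>

definition words_over :: "'a set \<Rightarrow> ('a \<times> bool) list set" where
  "words_over B = {w. fst ` set w \<subseteq> B}"

lemma words_over_Nil [simp]: "[] \<in> words_over B"
  by (simp add: words_over_def)

lemma words_over_Cons [simp]: "l # w \<in> words_over B \<longleftrightarrow> fst l \<in> B \<and> w \<in> words_over B"
  by (simp add: words_over_def)

lemma words_over_append [simp]: "v @ w \<in> words_over B \<longleftrightarrow> v \<in> words_over B \<and> w \<in> words_over B"
  by (auto simp: words_over_def)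

lemma words_over_mono: "w \<in> words_over B \<Longrightarrow> B \<subseteq> C \<Longrightarrow> w \<in> words_over C"
  by (auto simp: words_over_def)

lemma word_value_Nil [simp]: "word_value G [] = \<one>\<^bsub>G\<^esub>"
  by (simp add: word_value_def)

lemma word_value_Cons [simp]:
  "word_value G (l # w) = letter_value G l \<otimes>\<^bsub>G\<^esub> word_value G w"
  by (simp add: word_value_def)

context group
begin

lemma letter_value_closed: "fst l \<in> carrier G \<Longrightarrow> letter_value G l \<in> carrier G"
  by (simp add: letter_value_def)

lemma word_value_closed: "w \<in> words_over (carrier G) \<Longrightarrow> word_value G w \<in> carrier G"
  by (induction w) (auto intro: letter_value_closed)

lemma word_value_append:
  "v \<in> words_over (carrier G) \<Longrightarrow> w \<in> words_over (carrier G) \<Longrightarrow>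
    word_value G (v @ w) = word_value G v \<otimes> word_value G w"
  by (induction v) (auto simp: m_assoc letter_value_closed word_value_closed)

lemma letter_value_cancel:
  assumes "fst l \<in> carrier G" "fst l = fst l'" "snd l \<noteq> snd l'"
  shows "letter_value G l \<otimes> letter_value G l' = \<one>"
  using assms by (auto simp: letter_value_def)

lemma word_value_cancel:
  assumes "fst l \<in> carrier G" "fst l = fst l'" "snd l \<noteq> snd l'" "w \<in> words_over (carrier G)"
  shows "word_value G (l # l' # w) = word_value G w"
proof -
  have "word_value G (l # l' # w) = letter_value G l \<otimes> letter_value G l' \<otimes> word_value G w"
    using assms by (simp add: m_assoc letter_value_closed word_value_closed)
  then show ?thesis
    using assms by (simp add: letter_value_cancel word_value_closed)
qed

lemma generate_word:
  assumes "S \<subseteq> carrier G" "g \<in> generate G S"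
  shows "\<exists>w \<in> words_over S. word_value G w = g"
  using assms(2)
proof induction
  case one
  show ?case by (rule bexI[of _ "[]"]) simp_all
next
  case (incl h)
  then show ?case using assms(1)
    by (intro bexI[of _ "[(h, True)]"]) (auto simp: letter_value_def)
next
  case (inv h)
  then show ?case using assms(1)
    by (intro bexI[of _ "[(h, False)]"]) (auto simp: letter_value_def)
next
  case (eng h1 h2)
  then obtain w1 w2 where "w1 \<in> words_over S" "word_value G w1 = h1"
    "w2 \<in> words_over S" "word_value G w2 = h2" by blast
  then show ?case using assms(1)
    by (intro bexI[of _ "w1 @ w2"]) (auto simp: word_value_append words_over_mono)
qed

lemma conjugate_in_refl: "g \<in> carrier G \<Longrightarrow> conjugate_in G g g"
  unfolding conjugate_in_def by (rule bexI[of _ \<one>]) simp_all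

lemma conjugate_in_imp_commute:
  assumes "g \<in> carrier G" "conjugate_in G g h"
  shows "\<exists>x \<in> carrier G. h \<otimes> x = x \<otimes> g"
proof -
  obtain x where x: "x \<in> carrier G" "h = x \<otimes> g \<otimes> inv x"
    using assms(2) unfolding conjugate_in_def by blast
  have "h \<otimes> x = x \<otimes> g" unfolding x(2) using assms(1) x(1) by (simp add: m_assoc)
  with x(1) show ?thesis by blast
qed

lemma conjugate_in_sym: "g \<in> carrier G \<Longrightarrow> conjugate_in G g h \<Longrightarrow> conjugate_in G h g"
  unfolding conjugate_in_def
proof (elim bexE)
  fix x assume g: "g \<in> carrier G" and x: "x \<in> carrier G" and h: "h = x \<otimes> g \<otimes> inv x"
  have "inv x \<otimes> h \<otimes> inv (inv x) = (inv x \<otimes> x) \<otimes> g \<otimes> (inv x \<otimes> x)"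
    unfolding h using g x by (simp only: m_assoc inv_closed m_closed inv_inv)
  then have "g = inv x \<otimes> h \<otimes> inv (inv x)" using g x by simp
  then show "\<exists>y\<in>carrier G. g = y \<otimes> h \<otimes> inv y" using x by blast
qed

lemma conjugate_in_trans:
  "g \<in> carrier G \<Longrightarrow> conjugate_in G g h \<Longrightarrow> conjugate_in G h k \<Longrightarrow> conjugate_in G g k"
  unfolding conjugate_in_def
proof (elim bexE)
  fix x y assume g: "g \<in> carrier G" and x: "x \<in> carrier G" and h: "h = x \<otimes> g \<otimes> inv x"
    and y: "y \<in> carrier G" and k: "k = y \<otimes> h \<otimes> inv y"
  have "k = (y \<otimes> x) \<otimes> g \<otimes> inv (y \<otimes> x)"
    unfolding k h using g x y by (simp add: m_assoc inv_mult_group)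
  then show "\<exists>z\<in>carrier G. k = z \<otimes> g \<otimes> inv z" using x y by blast
qed

lemma conjugate_in_word_value_rotate:
  assumes "w \<in> words_over (carrier G)"
  shows "conjugate_in G (word_value G w) (word_value G (rotate k w))"
proof -
  let ?j = "k mod length w"
  let ?x = "word_value G (take ?j w)" and ?y = "word_value G (drop ?j w)"
  have "take ?j w @ drop ?j w \<in> words_over (carrier G)" using assms by simp
  then have mem: "take ?j w \<in> words_over (carrier G)" "drop ?j w \<in> words_over (carrier G)"
    unfolding words_over_append by blast+
  then have x: "?x \<in> carrier G" and y: "?y \<in> carrier G" by (auto intro: word_value_closed)
  have w: "word_value G w = ?x \<otimes> ?y"
    using word_value_append[OF mem] by simp
  have r: "word_value G (rotate k w) = ?y \<otimes> ?x"
    using word_value_append[OF mem(2,1)] by (simp add: rotate_drop_take)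
  have "?y \<otimes> ?x = inv ?x \<otimes> (?x \<otimes> ?y) \<otimes> inv (inv ?x)"
    using x y by (simp flip: m_assoc)
  then show ?thesis
    unfolding conjugate_in_def w r using x by blast
qed

end


section \<open>The universal property of a free basis\<close>

text \<open>
  Prepending a letter to a word, cancelling it against the first letter if the two are inverse to each
  other. Iterating this from the right end of a word yields its reduced form.
\<close>

definition cancel_Cons :: "'a \<times> bool \<Rightarrow> ('a \<times> bool) list \<Rightarrow> ('a \<times> bool) list" where
  "cancel_Cons l w =
    (if w \<noteq> [] \<and> fst l = fst (hd w) \<and> snd l \<noteq> snd (hd w) then tl w else l # w)"

definition free_reduction :: "('a \<times> bool) list \<Rightarrow> ('a \<times> bool) list" where
  "free_reduction w = foldr cancel_Cons w []"

lemma reduced_cancel_Cons: "reduced w \<Longrightarrow> reduced (cancel_Cons l w)"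
  by (cases w) (auto simp: reduced_def cancel_Cons_def successively_Cons)

lemma reduced_free_reduction: "reduced (free_reduction w)"
  unfolding free_reduction_def
  by (induction w) (simp_all add: reduced_cancel_Cons, simp add: reduced_def)

lemma set_cancel_Cons: "set (cancel_Cons l w) \<subseteq> insert l (set w)"
  by (cases w) (auto simp: cancel_Cons_def)

lemma set_free_reduction: "set (free_reduction w) \<subseteq> set w"
  unfolding free_reduction_def
proof (induction w)
  case (Cons l w)
  then show ?case using set_cancel_Cons[of l "foldr cancel_Cons w []"] by auto
qed simp

lemma free_reduction_words_over: "w \<in> words_over B \<Longrightarrow> free_reduction w \<in> words_over B"
  using set_free_reduction[of w] by (auto simp: words_over_def)

lemma map_words_over: "w \<in> words_over B \<Longrightarrow> f ` B \<subseteq> C \<Longrightarrow> map (apfst f) w \<in> words_over C"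
  by (fastforce simp: words_over_def)

text \<open>
  The map \<open>f\<close> substitutes arbitrary group elements for the letters. The substituted word need not be
  reduced, even when \<open>free_reduction w\<close> is.
\<close>

lemma (in group) word_value_free_reduction:
  assumes "w \<in> words_over B" "f ` B \<subseteq> carrier G"
  shows "word_value G (map (apfst f) (free_reduction w)) = word_value G (map (apfst f) w)"
  using assms(1)
proof (induction w)
  case Nil
  then show ?case by (simp add: free_reduction_def)
next
  case (Cons l w)
  let ?r = "free_reduction w" and ?m = "map (apfst f)"
  have red: "free_reduction (l # w) = cancel_Cons l ?r" by (simp add: free_reduction_def)
  have l: "fst l \<in> B" and w: "w \<in> words_over B" using Cons.prems by auto
  have r: "?r \<in> words_over B" using w by (rule free_reduction_words_over)
  have IH: "word_value G (?m ?r) = word_value G (?m w)" using Cons.IH[OF w] .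
  show ?case
  proof (cases "?r \<noteq> [] \<and> fst l = fst (hd ?r) \<and> snd l \<noteq> snd (hd ?r)")
    case True
    then obtain l' r' where r': "?r = l' # r'" "fst l = fst l'" "snd l \<noteq> snd l'"
      by (cases ?r) auto
    have mem: "?m r' \<in> words_over (carrier G)"
      using r r' assms(2) by (auto intro!: map_words_over)
    have "word_value G (?m (l # ?r)) = word_value G (?m r')"
      unfolding r'(1) list.map using l r' assms(2) mem
      by (intro word_value_cancel) auto
    then have "word_value G (?m r') = word_value G (?m (l # w))"
      using IH by simp
    then show ?thesis using True r'(1) unfolding red cancel_Cons_def by simp
  next
    case False
    then show ?thesis using IH by (simp add: red cancel_Cons_def if_not_P)
  qed
qed

lemma free_basis_reduced_word:
  assumes "free_basis G B" "g \<in> carrier G"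
  shows "\<exists>w \<in> words_over B. word_value G w = g"
proof -
  have "g \<in> word_value G ` reduced_words B"
    using assms by (auto simp: free_basis_def bij_betw_def)
  then show ?thesis by (auto simp: reduced_words_def words_over_def)
qed

lemma free_basis_extend_hom:
  assumes G: "group G" and H: "group H" and B: "free_basis G B" and f: "f ` B \<subseteq> carrier H"
  shows "\<exists>\<phi> \<in> hom G H. \<forall>w \<in> words_over B.
    \<phi> (word_value G w) = word_value H (map (apfst f) w)"
proof -
  interpret G: group G by fact
  interpret H: group H by fact
  define \<phi> where "\<phi> g = word_value H (map (apfst f)
    (inv_into (reduced_words B) (word_value G) g))" for g
  have BG: "B \<subseteq> carrier G" and bij: "bij_betw (word_value G) (reduced_words B) (carrier G)"
    using B by (auto simp: free_basis_def)
  have val: "\<phi> (word_value G w) = word_value H (map (apfst f) w)" if w: "w \<in> words_over B" for w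
  proof -
    have "free_reduction w \<in> reduced_words B"
      using free_reduction_words_over[OF w] reduced_free_reduction
      by (auto simp: reduced_words_def words_over_def)
    moreover have "word_value G (free_reduction w) = word_value G w"
      using G.word_value_free_reduction[OF w, of id] BG by (simp add: apfst_id)
    ultimately have "inv_into (reduced_words B) (word_value G) (word_value G w) = free_reduction w"
      using bij by (metis bij_betw_def inv_into_f_f)
    then show ?thesis
      unfolding \<phi>_def using H.word_value_free_reduction[OF w f] by simp
  qed
  have "\<phi> \<in> hom G H"
  proof (rule homI)
    fix g assume "g \<in> carrier G"
    then obtain v where v: "v \<in> words_over B" "word_value G v = g"
      using free_basis_reduced_word[OF B] by blast
    show "\<phi> g \<in> carrier H"
      using val[OF v(1)] v H.word_value_closed[OF map_words_over[OF v(1) f]] by simp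
    fix h assume "h \<in> carrier G"
    then obtain w where w: "w \<in> words_over B" "word_value G w = h"
      using free_basis_reduced_word[OF B] by blast
    have "word_value G (v @ w) = g \<otimes>\<^bsub>G\<^esub> h"
      using v w BG by (simp add: G.word_value_append words_over_mono)
    then show "\<phi> (g \<otimes>\<^bsub>G\<^esub> h) = \<phi> g \<otimes>\<^bsub>H\<^esub> \<phi> h"
      using val[of "v @ w"] val[OF v(1)] val[OF w(1)] v w
      by (simp add: H.word_value_append map_words_over[OF _ f])
  qed
  with val show ?thesis by blast
qed


section \<open>Cyclically reduced words\<close>

text \<open>
  No two cyclically adjacent letters are inverse to each other. Such a word is also reduced. Words of
  length at most one always qualify, since a letter is not its own inverse.
\<close>

definition cyclically_reduced :: "('a \<times> bool) list \<Rightarrow> bool" where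
  "cyclically_reduced w \<longleftrightarrow> (\<forall>i < length w.
    fst (w ! i) = fst (w ! (Suc i mod length w)) \<longrightarrow> snd (w ! i) = snd (w ! (Suc i mod length w)))"

text \<open>
  As long as two cyclically adjacent letters are inverse to each other, a rotation brings them to the
  front, where they cancel.
\<close>

lemma (in group) cyclically_reduced_conjugate:
  assumes B: "B \<subseteq> carrier G" and w: "w \<in> words_over B"
  shows "\<exists>u \<in> words_over B. cyclically_reduced u \<and> length u \<le> length w \<and>
    conjugate_in G (word_value G w) (word_value G u)"
  using w
proof (induction "length w" arbitrary: w rule: less_induct)
  case less
  have wG: "w \<in> words_over (carrier G)" using less.prems B by (rule words_over_mono)
  show ?case
  proof (cases "cyclically_reduced w")
    case True
    then show ?thesis using less.prems conjugate_in_refl[OF word_value_closed[OF wG]] by auto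
  next
    case False
    then obtain i where i: "i < length w" "fst (w ! i) = fst (w ! (Suc i mod length w))"
      "snd (w ! i) \<noteq> snd (w ! (Suc i mod length w))"
      unfolding cyclically_reduced_def by blast
    have len: "length w \<ge> 2"
    proof (rule ccontr)
      assume "\<not> length w \<ge> 2"
      with i(1) have "i = 0" "length w = 1" by linarith+
      with i(3) show False by simp
    qed
    obtain l l' v where r: "rotate i w = l # l' # v"
      using len by (metis Suc_le_length_iff length_rotate numeral_2_eq_2)
    have "l = rotate i w ! 0" "l' = rotate i w ! 1" using r by simp_all
    moreover have "rotate i w ! 0 = w ! i" "rotate i w ! 1 = w ! (Suc i mod length w)"
      using i(1) len nth_rotate[of 0 w i] nth_rotate[of 1 w i] by fastforce+
    ultimately have l: "l = w ! i" "l' = w ! (Suc i mod length w)" by simp_all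
    have "rotate i w \<in> words_over B" using less.prems by (simp add: words_over_def)
    then have v: "v \<in> words_over B" and "fst l \<in> B" unfolding r by auto
    then have "word_value G (rotate i w) = word_value G v"
      unfolding r using i l B by (intro word_value_cancel) (auto intro: words_over_mono)
    then have conj: "conjugate_in G (word_value G w) (word_value G v)"
      using conjugate_in_word_value_rotate[OF wG, of i] by simp
    have lv: "length v < length w" using arg_cong[OF r, of length] by simp
    from less.hyps[OF lv v] obtain u where "u \<in> words_over B" "cyclically_reduced u"
      "length u \<le> length v" "conjugate_in G (word_value G v) (word_value G u)" by blast
    then show ?thesis
      using conj lv conjugate_in_trans[OF word_value_closed[OF wG]] by (meson less_imp_le order_trans)
  qed
qed


section \<open>A permutation action tracing a cyclically reduced word\<close>

lemma mult_BijGroup_apply: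
  "f \<in> Bij V \<Longrightarrow> g \<in> Bij V \<Longrightarrow> x \<in> V \<Longrightarrow> (f \<otimes>\<^bsub>BijGroup V\<^esub> g) x = f (g x)"
  by (simp add: BijGroup_def compose_def)

lemma card_Bij_le:
  assumes "finite V"
  shows "finite (Bij V)" "card (Bij V) \<le> card V ^ card V"
proof -
  have sub: "Bij V \<subseteq> V \<rightarrow>\<^sub>E V" by (auto simp: Bij_def PiE_def bij_betw_def)
  have fin: "finite (V \<rightarrow>\<^sub>E V)" using assms by (simp add: finite_PiE)
  show "finite (Bij V)" using finite_subset[OF sub fin] .
  show "card (Bij V) \<le> card V ^ card V"
    using card_mono[OF fin sub] card_PiE[OF assms, of "\<lambda>_. V"] by simp
qed

text \<open>The domain and the range of the relation \<open>R\<close> have complements of the same size.\<close>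

lemma partial_injection_extend_permutation:
  assumes fin: "finite V" and R: "R \<subseteq> V \<times> V"
    and inj: "\<And>x y x' y'. (x, y) \<in> R \<Longrightarrow> (x', y') \<in> R \<Longrightarrow> x = x' \<longleftrightarrow> y = y'"
  shows "\<exists>\<pi>. \<pi> permutes V \<and> (\<forall>(x, y) \<in> R. \<pi> x = y)"
proof -
  define p where "p x = (THE y. (x, y) \<in> R)" for x
  have p: "p x = y" if "(x, y) \<in> R" for x y
    unfolding p_def using that inj by blast
  have bp: "bij_betw p (Domain R) (Range R)"
    unfolding bij_betw_def
  proof
    show "inj_on p (Domain R)"
      by (rule inj_onI) (metis Domain.cases inj p)
    show "p ` Domain R = Range R"
      using p by (force simp: image_iff)
  qed
  have sub: "Domain R \<subseteq> V" "Range R \<subseteq> V" using R by auto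
  have "card (V - Domain R) = card (V - Range R)"
    using bij_betw_same_card[OF bp] sub fin by (simp add: card_Diff_subset finite_subset)
  then obtain p' where p': "bij_betw p' (V - Domain R) (V - Range R)"
    using fin by (metis finite_Diff finite_same_card_bij)
  define \<pi> where "\<pi> x = (if x \<in> Domain R then p x else if x \<in> V then p' x else x)" for x
  have "bij_betw \<pi> (Domain R) (Range R)"
    using bp by (rule bij_betw_cong[THEN iffD1, rotated]) (simp add: \<pi>_def)
  moreover have "bij_betw \<pi> (V - Domain R) (V - Range R)"
    using p' by (rule bij_betw_cong[THEN iffD1, rotated]) (simp add: \<pi>_def)
  ultimately have "bij_betw \<pi> (Domain R \<union> (V - Domain R)) (Range R \<union> (V - Range R))"
    by (rule bij_betw_combine) blast
  then have "bij_betw \<pi> V V" using sub by (simp add: Un_absorb1)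
  then have "\<pi> permutes V"
    using sub by (intro bij_imp_permutes) (auto simp: \<pi>_def)
  moreover have "\<forall>(x, y) \<in> R. \<pi> x = y" using p by (auto simp: \<pi>_def)
  ultimately show ?thesis by blast
qed

lemma Suc_mod_inject:
  assumes "i < n" "j < n" "Suc i mod n = Suc j mod n"
  shows "i = j"
  using assms by (auto simp: mod_Suc split: if_splits)

text \<open>
  The cycle labelled by a nonempty cyclically reduced word \<open>u\<close> of length \<open>n\<close>. Word values are products
  read from the left while permutations compose to the right, so the last letter of a word acts
  first. Accordingly the letter \<open>u ! i\<close> moves the vertex \<open>Suc i mod n\<close> to \<open>i\<close>; this is the forward
  direction of the edge number \<open>i\<close>.
\<close>

locale cyclic_word =
  fixes u :: "('a \<times> bool) list"
  assumes nonempty: "u \<noteq> []" and cyclic: "cyclically_reduced u"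
begin

abbreviation n :: nat where "n \<equiv> length u"

lemma n_pos: "n > 0"
  using nonempty by simp

lemma no_cancel: "i < n \<Longrightarrow> u ! i = (b, e) \<Longrightarrow> u ! (Suc i mod n) = (b, e') \<Longrightarrow> e = e'"
  using cyclic unfolding cyclically_reduced_def by (metis fst_conv snd_conv)

lemma vertex_perm_exists:
  "\<exists>\<pi>. \<pi> permutes {..<n} \<and> (\<forall>i<n. u ! i = (b, True) \<longrightarrow> \<pi> (Suc i mod n) = i) \<and>
    (\<forall>i<n. u ! i = (b, False) \<longrightarrow> \<pi> i = Suc i mod n)"
proof -
  \<comment> \<open>A letter \<open>(b, False)\<close> at position \<open>i\<close> is a backward traversal of an edge labelled \<open>b\<close>.\<close>
  define R where "R = {(Suc i mod n, i) |i. i < n \<and> u ! i = (b, True)} \<union>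
    {(i, Suc i mod n) |i. i < n \<and> u ! i = (b, False)}"
  have "\<exists>\<pi>. \<pi> permutes {..<n} \<and> (\<forall>(x, y) \<in> R. \<pi> x = y)"
  proof (rule partial_injection_extend_permutation)
    show "R \<subseteq> {..<n} \<times> {..<n}" using n_pos by (auto simp: R_def)
    show "x = x' \<longleftrightarrow> y = y'" if "(x, y) \<in> R" "(x', y') \<in> R" for x y x' y'
      using that Suc_mod_inject[of _ n] no_cancel[of _ b True False] no_cancel[of _ b False True]
      unfolding R_def by auto
  qed simp
  then obtain \<pi> where "\<pi> permutes {..<n}" "\<And>x y. (x, y) \<in> R \<Longrightarrow> \<pi> x = y" by fast
  then show ?thesis by (intro exI[of _ \<pi>]) (auto simp: R_def)
qed

text \<open>
  The permutation of the vertices by which the letter \<open>(b, True)\<close> acts: any one that agrees with the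
  edges of the cycle labelled by \<open>b\<close>.
\<close>

definition vertex_perm :: "'a \<Rightarrow> nat \<Rightarrow> nat" where
  "vertex_perm b = (SOME \<pi>. \<pi> permutes {..<n} \<and>
    (\<forall>i<n. u ! i = (b, True) \<longrightarrow> \<pi> (Suc i mod n) = i) \<and>
    (\<forall>i<n. u ! i = (b, False) \<longrightarrow> \<pi> i = Suc i mod n))"

lemma vertex_perm_permutes: "vertex_perm b permutes {..<n}"
  and vertex_perm_True: "i < n \<Longrightarrow> u ! i = (b, True) \<Longrightarrow> vertex_perm b (Suc i mod n) = i"
  and vertex_perm_False: "i < n \<Longrightarrow> u ! i = (b, False) \<Longrightarrow> vertex_perm b i = Suc i mod n"
  using someI_ex[OF vertex_perm_exists[of b]] unfolding vertex_perm_def[symmetric] by blast+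

text \<open>
  The weight of the edge labelled \<open>b\<close> that starts at the vertex \<open>v\<close>: \<open>1\<close> if it is an edge of the
  cycle pointing forward, \<open>-1\<close> if it is one pointing backward, and \<open>0\<close> if it is not on the cycle.
\<close>

definition weight :: "'a \<Rightarrow> nat \<Rightarrow> int" where
  "weight b v = (if \<exists>i<n. u ! i = (b, True) \<and> v = Suc i mod n then 1
    else if v < n \<and> u ! v = (b, False) then - 1 else 0)"

lemma weight_True: "i < n \<Longrightarrow> u ! i = (b, True) \<Longrightarrow> weight b (Suc i mod n) = 1"
  by (auto simp: weight_def)

lemma weight_False:
  assumes "i < n" "u ! i = (b, False)"
  shows "weight b i = - 1"
  using assms no_cancel[of _ b True False] by (auto simp: weight_def)

text \<open>
  The action of a letter on pairs of a vertex and an accumulated integer weight. The letter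
  \<open>(b, False)\<close> traverses the edge labelled \<open>b\<close> that ends at the current vertex in reverse.
\<close>

fun step :: "'a \<times> bool \<Rightarrow> nat \<times> int \<Rightarrow> nat \<times> int" where
  "step (b, True) (v, a) = (vertex_perm b v, a + weight b v)"
| "step (b, False) (v, a) = (inv_into UNIV (vertex_perm b) v, a - weight b (inv_into UNIV (vertex_perm b) v))"

lemma step_inverse: "step (b, \<not> e) (step (b, e) x) = x"
  by (cases x; cases e) (simp_all add: permutes_inverses[OF vertex_perm_permutes])

lemma step_vertex: "v < n \<Longrightarrow> fst (step l (v, a)) < n"
  using permutes_in_image[OF vertex_perm_permutes] permutes_in_image[OF permutes_inv[OF vertex_perm_permutes]]
  by (cases l; cases "snd l") auto

lemma step_le: "\<bar>snd (step l (v, a)) - a\<bar> \<le> 1"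
  by (cases l; cases "snd l") (auto simp: weight_def)

lemma step_translate: "step l (v, a + c) = (fst (step l (v, a)), snd (step l (v, a)) + c)"
  by (cases l; cases "snd l") auto

lemma step_along:
  assumes "i < n"
  shows "step (u ! i) (Suc i mod n, a) = (i, a + 1)"
proof -
  obtain b e where l: "u ! i = (b, e)" by fastforce
  show ?thesis
  proof (cases e)
    case True
    with l show ?thesis
      using vertex_perm_True[OF assms, of b] weight_True[OF assms, of b] by simp
  next
    case False
    with l have "inv_into UNIV (vertex_perm b) (Suc i mod n) = i"
      using vertex_perm_False[OF assms, of b]
      by (metis permutes_inverses(2)[OF vertex_perm_permutes])
    with l False show ?thesis using weight_False[OF assms, of b] by simp
  qed
qed

lemma step_forward:
  assumes "v < n" "snd (step l (v, a)) = a + 1"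
  shows "l = u ! fst (step l (v, a)) \<and> v = Suc (fst (step l (v, a))) mod n"
proof (cases l)
  case (Pair b e)
  show ?thesis
  proof (cases e)
    case True
    then have "weight b v = 1" using assms Pair by simp
    then obtain i where "i < n" "u ! i = (b, True)" "v = Suc i mod n"
      by (auto simp: weight_def split: if_splits)
    then show ?thesis using Pair True vertex_perm_True by simp
  next
    case False
    let ?i = "inv_into UNIV (vertex_perm b) v"
    have "weight b ?i = - 1" using assms Pair False by simp
    then have i: "?i < n" "u ! ?i = (b, False)"
      by (auto simp: weight_def split: if_splits)
    then have "v = Suc ?i mod n"
      using vertex_perm_False[OF i] permutes_inverses(1)[OF vertex_perm_permutes] by metis
    then show ?thesis using Pair False i by simp
  qed
qed

text \<open>The action of a whole word, last letter first.\<close>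

abbreviation run :: "('a \<times> bool) list \<Rightarrow> nat \<times> int \<Rightarrow> nat \<times> int" where
  "run w \<equiv> foldr step w"

lemma run_vertex: "v < n \<Longrightarrow> fst (run w (v, a)) < n"
proof (induction w)
  case (Cons l w)
  then show ?case using step_vertex[of "fst (run w (v, a))" l "snd (run w (v, a))"] by simp
qed simp

lemma run_le: "\<bar>snd (run w (v, a)) - a\<bar> \<le> int (length w)"
proof (induction w)
  case (Cons l w)
  then show ?case using step_le[of l "fst (run w (v, a))" "snd (run w (v, a))"] by simp
qed simp

lemma run_translate: "run w (v, a + c) = (fst (run w (v, a)), snd (run w (v, a)) + c)"
proof (induction w)
  case (Cons l w)
  then show ?case using step_translate[of l "fst (run w (v, a))" "snd (run w (v, a))" c] by simp
qed simp

lemma run_cycle: "run u (0, a) = (0, a + int n)"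
proof -
  have "run (drop (n - k) u) (0, a) = ((n - k) mod n, a + int k)" if "k \<le> n" for k
    using that
  proof (induction k)
    case (Suc k)
    let ?i = "n - Suc k"
    have i: "?i < n" "Suc ?i = n - k" using Suc.prems by auto
    have "drop ?i u = u ! ?i # drop (n - k) u"
      using Cons_nth_drop_Suc[OF i(1)] i(2) by simp
    then have "run (drop ?i u) (0, a) = step (u ! ?i) (Suc ?i mod n, a + int k)"
      using Suc i by simp
    then show ?case using step_along[OF i(1)] i by simp
  qed simp
  from this[of n] show ?thesis by simp
qed

text \<open>
  A word that gains the largest possible weight runs forward along the cycle all the way, so it can be
  read off the cycle from the vertex where it ends.
\<close>

lemma run_forward:
  assumes "v < n" "snd (run w (v, a)) = a + int (length w)"
  shows "w = map (\<lambda>j. u ! ((fst (run w (v, a)) + j) mod n)) [0..<length w]"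
  using assms(2)
proof (induction w)
  case (Cons l w)
  obtain v' a' where va: "run w (v, a) = (v', a')" by fastforce
  have v': "v' < n" using run_vertex[OF assms(1), of w a] va by simp
  have a': "\<bar>a' - a\<bar> \<le> int (length w)" using run_le[of w v a] va by simp
  have s: "snd (step l (v', a')) = a + int (length w) + 1" using Cons.prems va by simp
  then have a'_eq: "a' = a + int (length w)" using a' step_le[of l v' a'] by linarith
  let ?k = "fst (step l (v', a'))"
  have k: "?k < n" using step_vertex[OF v'] .
  have f: "l = u ! ?k" "v' = Suc ?k mod n"
    using step_forward[OF v', of l a'] s a'_eq by auto
  have IH: "w = map (\<lambda>j. u ! ((v' + j) mod n)) [0..<length w]"
    using Cons.IH a'_eq va by simp
  have "u ! ((v' + j) mod n) = u ! ((?k + Suc j) mod n)" for j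
    by (subst f(2)) (simp add: mod_simps)
  then have "w = map (\<lambda>j. u ! ((?k + Suc j) mod n)) [0..<length w]"
    using IH by simp
  then have "l # w = map (\<lambda>j. u ! ((?k + j) mod n)) [0..<length (l # w)]"
    using f(1) k by (simp add: upt_conv_Cons map_Suc_upt[symmetric] comp_def del: upt_Suc)
  moreover have "fst (run (l # w) (v, a)) = ?k" using va by simp
  ultimately show ?case by (simp only:)
qed simp

text \<open>
  Words of length at most \<open>n\<close> have weights between \<open>-n\<close> and \<open>n\<close>, which are distinct modulo \<open>2n + 1\<close>.
\<close>

abbreviation q :: int where "q \<equiv> 2 * int n + 1"

text \<open>The finite set acted upon, and the action of a letter on it, with weights reduced modulo \<open>q\<close>.\<close>

definition cover_points :: "(nat \<times> int) set" where
  "cover_points = {..<n} \<times> {0..<q}"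

lemma finite_cover_points: "finite cover_points"
  and card_cover_points: "card cover_points = n * (2 * n + 1)"
  by (simp_all add: cover_points_def nat_add_distrib nat_mult_distrib)

definition cover_step :: "'a \<times> bool \<Rightarrow> nat \<times> int \<Rightarrow> nat \<times> int" where
  "cover_step l = (\<lambda>x \<in> cover_points. apsnd (\<lambda>a. a mod q) (step l x))"

lemma step_mod: "apsnd (\<lambda>a. a mod q) (step l (apsnd (\<lambda>a. a mod q) x)) =
    apsnd (\<lambda>a. a mod q) (step l x)"
  by (cases x; cases l; cases "snd l") (auto simp: mod_simps)

lemma cover_step_closed: "x \<in> cover_points \<Longrightarrow> cover_step l x \<in> cover_points"
  using step_vertex[of "fst x" l "snd x"] pos_mod_bound[of q "snd (step l x)"]
  by (simp add: cover_points_def cover_step_def mem_Times_iff)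

lemma mod_cover_points: "x \<in> cover_points \<Longrightarrow> apsnd (\<lambda>a. a mod q) x = x"
  by (auto simp: cover_points_def)

lemma cover_step_inverse:
  assumes "x \<in> cover_points"
  shows "cover_step (b, \<not> e) (cover_step (b, e) x) = x"
proof -
  have "cover_step (b, \<not> e) (cover_step (b, e) x) =
      apsnd (\<lambda>a. a mod q) (step (b, \<not> e) (apsnd (\<lambda>a. a mod q) (step (b, e) x)))"
    using assms cover_step_closed[OF assms] by (simp add: cover_step_def)
  then show ?thesis by (simp only: step_mod step_inverse mod_cover_points[OF assms])
qed

lemma cover_step_Bij: "cover_step l \<in> Bij cover_points"
proof (cases l)
  case (Pair b e)
  have "bij_betw (cover_step (b, e)) cover_points cover_points"
    using cover_step_inverse[of _ b e] cover_step_inverse[of _ b "\<not> e"]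
    by (intro bij_betwI[where g = "cover_step (b, \<not> e)"]) (auto simp: cover_step_closed)
  then show ?thesis using Pair by (auto simp: Bij_def cover_step_def)
qed

lemma letter_value_cover:
  "letter_value (BijGroup cover_points) (apfst (\<lambda>b. cover_step (b, True)) l) = cover_step l"
proof (cases l)
  case (Pair b e)
  interpret group "BijGroup cover_points" by (rule group_BijGroup)
  have "cover_step (b, False) \<otimes>\<^bsub>BijGroup cover_points\<^esub> cover_step (b, True) = \<one>\<^bsub>BijGroup cover_points\<^esub>"
    using cover_step_inverse[of _ b True]
    by (auto simp: BijGroup_def cover_step_Bij compose_def intro!: restrict_ext)
  then have "inv\<^bsub>BijGroup cover_points\<^esub> cover_step (b, True) = cover_step (b, False)"
    by (rule inv_equality) (simp_all add: BijGroup_def cover_step_Bij)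
  then show ?thesis using Pair by (cases e) (simp_all add: letter_value_def)
qed

lemma word_value_cover:
  assumes "x \<in> cover_points"
  shows "word_value (BijGroup cover_points) (map (apfst (\<lambda>b. cover_step (b, True))) w) x =
    apsnd (\<lambda>a. a mod q) (run w x)"
proof (induction w)
  case Nil
  then show ?case using assms mod_cover_points[OF assms] by (simp add: BijGroup_def)
next
  case (Cons l w)
  interpret group "BijGroup cover_points" by (rule group_BijGroup)
  let ?m = "map (apfst (\<lambda>b. cover_step (b, True)))"
  let ?y = "word_value (BijGroup cover_points) (?m w)"
  have "?m w \<in> words_over (carrier (BijGroup cover_points))"
    using cover_step_Bij by (auto simp: words_over_def BijGroup_def)
  then have "?y \<in> carrier (BijGroup cover_points)" by (rule word_value_closed)
  then have y: "?y \<in> Bij cover_points" by (simp only: BijGroup_def partial_object.simps)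
  then have yx: "?y x \<in> cover_points" using assms by (auto simp: Bij_def bij_betw_def)
  have "word_value (BijGroup cover_points) (?m (l # w)) x = cover_step l (?y x)"
    using mult_BijGroup_apply[OF cover_step_Bij y assms] by (simp only: list.map word_value_Cons letter_value_cover)
  also have "\<dots> = apsnd (\<lambda>a. a mod q) (step l (?y x))"
    using yx by (simp add: cover_step_def)
  also have "\<dots> = apsnd (\<lambda>a. a mod q) (run (l # w) x)"
    by (simp only: Cons step_mod foldr.simps comp_apply)
  finally show ?case .
qed

text \<open>
  The hypothesis says that \<open>w\<close> and \<open>u\<close> act as conjugate permutations of the cover, \<open>z\<close> being the
  conjugating word.
\<close>

lemma cover_separates:
  assumes "length w \<le> n"
    and eq: "\<And>x. x \<in> cover_points \<Longrightarrow>
      apsnd (\<lambda>a. a mod q) (run (w @ z) x) = apsnd (\<lambda>a. a mod q) (run (z @ u) x)"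
  shows "\<exists>k. w = rotate k u"
proof -
  have "(0, 0) \<in> cover_points" using n_pos by (simp add: cover_points_def)
  \<comment> \<open>The word \<open>z\<close> carries the point where \<open>u\<close> shifts the weight by \<open>n\<close> to one where \<open>w\<close> does so modulo \<open>q\<close>.\<close>
  note E = eq[OF this]
  obtain v a where z: "run z (0, 0) = (v, a)" by fastforce
  have v: "v < n" using run_vertex[of 0 z 0] n_pos z by simp
  have "run (z @ u) (0, 0) = (v, a + int n)"
    using run_translate[of z 0 0 "int n"] z by (simp add: run_cycle)
  then have "snd (run w (v, a)) mod q = (a + int n) mod q"
    using arg_cong[OF E, of snd] z by simp
  then have "q dvd snd (run w (v, a)) - a - int n"
    by (simp add: mod_eq_dvd_iff algebra_simps)
  moreover have "\<bar>snd (run w (v, a)) - a - int n\<bar> < q"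
    using run_le[of w v a] assms(1) by linarith
  ultimately have full: "snd (run w (v, a)) - a - int n = 0"
    using dvd_imp_le_int[of "snd (run w (v, a)) - a - int n" q] by linarith
  then have len: "length w = n" using run_le[of w v a] assms(1) by linarith
  have "w = map (\<lambda>j. u ! ((fst (run w (v, a)) + j) mod n)) [0..<n]"
    using run_forward[OF v, of w a] full len by simp
  also have "\<dots> = rotate (fst (run w (v, a))) u"
    by (rule nth_equalityI) (simp_all add: nth_rotate)
  finally show ?thesis by blast
qed

end


section \<open>Finite quotients separating conjugacy classes\<close>

lemma quotient_separating:
  assumes G: "group G" and B: "free_basis G B" and u: "u \<in> words_over B" "cyclically_reduced u"
    "u \<noteq> []"
  shows "\<exists>N. N \<lhd> G \<and> finite (carrier (G Mod N)) \<and>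
    order (G Mod N) \<le> (length u * (2 * length u + 1)) ^ (length u * (2 * length u + 1)) \<and>
    (\<forall>w \<in> words_over B. length w \<le> length u \<longrightarrow>
      conjugate_in (G Mod N) (N #>\<^bsub>G\<^esub> word_value G u) (N #>\<^bsub>G\<^esub> word_value G w) \<longrightarrow>
      conjugate_in G (word_value G u) (word_value G w))"
proof -
  interpret G: group G by fact
  interpret cyclic_word u using u by unfold_locales
  let ?X = "cover_points"
  let ?H = "BijGroup ?X"
  let ?m = "map (apfst (\<lambda>b. cover_step (b, True)))"
  interpret H: group ?H by (rule group_BijGroup)
  have BG: "B \<subseteq> carrier G" using B by (simp add: free_basis_def)
  have "(\<lambda>b. cover_step (b, True)) ` B \<subseteq> carrier ?H"
    using cover_step_Bij by (auto simp: BijGroup_def)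
  from free_basis_extend_hom[OF G H.is_group B this] obtain \<phi> where \<phi>: "\<phi> \<in> hom G ?H"
    and val: "\<And>w. w \<in> words_over B \<Longrightarrow> \<phi> (word_value G w) = word_value ?H (?m w)" by blast
  interpret \<phi>: group_hom G ?H \<phi> using \<phi> by unfold_locales
  let ?N = "kernel G ?H \<phi>"
  have N: "?N \<lhd> G" by (rule \<phi>.normal_kernel)
  interpret N: normal ?N G by (rule N)
  interpret Q: group "G Mod ?N" by (rule N.factorgroup_is_group)
  have Bij: "carrier ?H = Bij ?X" by (simp add: BijGroup_def)
  have inj: "inj_on (\<lambda>C. the_elem (\<phi> ` C)) (carrier (G Mod ?N))"
    by (rule \<phi>.FactGroup_inj_on)
  have into: "(\<lambda>C. the_elem (\<phi> ` C)) ` carrier (G Mod ?N) \<subseteq> Bij ?X"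
    using \<phi>.FactGroup_the_elem_mem Bij by blast
  have fin: "finite (carrier (G Mod ?N))"
    using inj_on_finite[OF inj into card_Bij_le(1)[OF finite_cover_points]] .
  have ord: "order (G Mod ?N) \<le> (n * (2 * n + 1)) ^ (n * (2 * n + 1))"
    using card_inj_on_le[OF inj into card_Bij_le(1)[OF finite_cover_points]]
      card_Bij_le(2)[OF finite_cover_points] unfolding order_def card_cover_points by linarith
  have sep: "conjugate_in G (word_value G u) (word_value G w)"
    if w: "w \<in> words_over B" "length w \<le> n"
      and conj: "conjugate_in (G Mod ?N) (?N #>\<^bsub>G\<^esub> word_value G u) (?N #>\<^bsub>G\<^esub> word_value G w)" for w
  proof -
    let ?g = "word_value G u" and ?h = "word_value G w"
    have g: "?g \<in> carrier G" and h: "?h \<in> carrier G"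
      using u w BG by (auto intro: G.word_value_closed words_over_mono)
    have gQ: "?N #>\<^bsub>G\<^esub> ?g \<in> carrier (G Mod ?N)"
      using g by (auto simp: FactGroup_def RCOSETS_def)
    obtain C where C: "C \<in> carrier (G Mod ?N)"
      and eq: "(?N #>\<^bsub>G\<^esub> ?h) \<otimes>\<^bsub>G Mod ?N\<^esub> C = C \<otimes>\<^bsub>G Mod ?N\<^esub> (?N #>\<^bsub>G\<^esub> ?g)"
      using Q.conjugate_in_imp_commute[OF gQ conj] by blast
    from C obtain x where x: "x \<in> carrier G" and Cx: "C = ?N #>\<^bsub>G\<^esub> x"
      by (auto simp: FactGroup_def RCOSETS_def)
    obtain z where z: "z \<in> words_over B" "word_value G z = x"
      using free_basis_reduced_word[OF B x] by blast
    from eq have "?N #>\<^bsub>G\<^esub> (?h \<otimes>\<^bsub>G\<^esub> x) = ?N #>\<^bsub>G\<^esub> (x \<otimes>\<^bsub>G\<^esub> ?g)"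
      unfolding Cx using g h x by (simp add: FactGroup_def N.rcos_sum)
    then have "?h \<otimes>\<^bsub>G\<^esub> x \<in> ?N #>\<^bsub>G\<^esub> (x \<otimes>\<^bsub>G\<^esub> ?g)"
      using G.rcos_self[OF G.m_closed[OF h x] N.is_subgroup] by simp
    then have "\<exists>k \<in> ?N. ?h \<otimes>\<^bsub>G\<^esub> x = k \<otimes>\<^bsub>G\<^esub> (x \<otimes>\<^bsub>G\<^esub> ?g)"
      by (simp only: r_coset_def UN_iff singleton_iff)
    then obtain k where k: "k \<in> ?N" "?h \<otimes>\<^bsub>G\<^esub> x = k \<otimes>\<^bsub>G\<^esub> (x \<otimes>\<^bsub>G\<^esub> ?g)"
      by (rule bexE)
    have kG: "k \<in> carrier G" and k1: "\<phi> k = \<one>\<^bsub>?H\<^esub>"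
      using k(1) unfolding kernel_def mem_Collect_eq by blast+
    have xg: "x \<otimes>\<^bsub>G\<^esub> ?g \<in> carrier G" using x g by (rule G.m_closed)
    have "\<phi> (?h \<otimes>\<^bsub>G\<^esub> x) = \<phi> (x \<otimes>\<^bsub>G\<^esub> ?g)"
      unfolding k(2) \<phi>.hom_mult[OF kG xg] k1 by (rule H.l_one[OF \<phi>.hom_closed[OF xg]])
    then have "\<phi> (word_value G (w @ z)) = \<phi> (word_value G (z @ u))"
      using z w u BG by (simp add: G.word_value_append words_over_mono)
    then have "word_value ?H (?m (w @ z)) = word_value ?H (?m (z @ u))"
      using val[of "w @ z"] val[of "z @ u"] z w u by simp
    then have "apsnd (\<lambda>a. a mod q) (run (w @ z) y) = apsnd (\<lambda>a. a mod q) (run (z @ u) y)"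
      if "y \<in> cover_points" for y
      using word_value_cover[OF that] by metis
    from cover_separates[OF w(2) this] obtain k where "w = rotate k u" by blast
    then show ?thesis
      using G.conjugate_in_word_value_rotate[of u k] u BG by (auto intro: words_over_mono)
  qed
  show ?thesis using N fin ord sep by blast
qed

text \<open>
  Word lengths over a finite set of elements bound word lengths over a free basis up to a constant
  factor.
\<close>

lemma rewrite_words_length:
  assumes G: "group G" and B: "free_basis G B" and S: "finite S" "S \<subseteq> carrier G"
  shows "\<exists>c. \<forall>w \<in> words_over S. \<exists>v \<in> words_over B.
    word_value G v = word_value G w \<and> length v \<le> c * length w"
proof -
  interpret group G by fact
  have BG: "B \<subseteq> carrier G" using B by (simp add: free_basis_def)
  have "\<exists>v. v \<in> words_over B \<and> word_value G v = letter_value G l" if "l \<in> S \<times> UNIV" for l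
  proof -
    have "letter_value G l \<in> carrier G"
      using that S(2) by (intro letter_value_closed) auto
    then show ?thesis using free_basis_reduced_word[OF B] by blast
  qed
  then have "\<exists>r. \<forall>l \<in> S \<times> UNIV. r l \<in> words_over B \<and> word_value G (r l) = letter_value G l"
    by (intro bchoice) blast
  then obtain r where r: "\<And>l. fst l \<in> S \<Longrightarrow> r l \<in> words_over B"
    "\<And>l. fst l \<in> S \<Longrightarrow> word_value G (r l) = letter_value G l"
    by (metis UNIV_I mem_Times_iff)
  define c where "c = (\<Sum>l \<in> S \<times> UNIV. length (r l))"
  have c: "length (r l) \<le> c" if "fst l \<in> S" for l
    unfolding c_def using that S(1) by (intro member_le_sum) (auto simp: mem_Times_iff)
  have "\<exists>v \<in> words_over B. word_value G v = word_value G w \<and> length v \<le> c * length w"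
    if "w \<in> words_over S" for w
    using that
  proof (induction w)
    case Nil
    show ?case by (rule bexI[of _ "[]"]) simp_all
  next
    case (Cons l w)
    then obtain v where v: "v \<in> words_over B" "word_value G v = word_value G w"
      "length v \<le> c * length w" by auto
    have l: "fst l \<in> S" using Cons.prems by simp
    show ?case
    proof (rule bexI[of _ "r l @ v"], intro conjI)
      show "word_value G (r l @ v) = word_value G (l # w)"
        using r[OF l] v BG by (simp add: word_value_append words_over_mono)
      show "length (r l @ v) \<le> c * length (l # w)"
        using c[OF l] v(3) by simp
      show "r l @ v \<in> words_over B"
        using r(1)[OF l] v(1) by simp
    qed
  qed
  then show ?thesis by blast
qed

lemma shortest_word:
  assumes "group G" "S \<subseteq> carrier G" "generate G S = carrier G" "g \<in> carrier G"
  shows "\<exists>w \<in> words_over S. word_value G w = g \<and> length w = word_length G S g"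
proof -
  interpret group G by fact
  let ?P = "\<lambda>k. \<exists>w. length w = k \<and> fst ` set w \<subseteq> S \<and> word_value G w = g"
  obtain w where "w \<in> words_over S" "word_value G w = g"
    using generate_word[OF assms(2)] assms(3,4) by blast
  then have "?P (length w)" by (auto simp: words_over_def)
  then have "?P (LEAST k. ?P k)" by (rule LeastI)
  then show ?thesis by (auto simp: words_over_def word_length_def)
qed

lemma (in normal) conjugate_in_quotient:
  assumes "g \<in> carrier G" "conjugate_in G g h"
  shows "conjugate_in (G Mod H) (H #> g) (H #> h)"
proof -
  interpret Q: group "G Mod H" by (rule factorgroup_is_group)
  obtain x where x: "x \<in> carrier G" "h = x \<otimes> g \<otimes> inv x"
    using assms(2) unfolding conjugate_in_def by blast
  have "H #> h = (H #> x) \<otimes>\<^bsub>G Mod H\<^esub> (H #> g) \<otimes>\<^bsub>G Mod H\<^esub> inv\<^bsub>G Mod H\<^esub> (H #> x)"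
  proof -
    have xQ: "H #> x \<in> carrier (G Mod H)"
      using x(1) by (auto simp: FactGroup_def RCOSETS_def)
    have "inv\<^bsub>G Mod H\<^esub> (H #> x) = H #> inv x"
      using inv_FactGroup[OF xQ] rcos_inv[OF x(1)] by simp
    then show ?thesis
      using x assms(1) by (simp add: rcos_sum)
  qed
  moreover have "H #> x \<in> carrier (G Mod H)"
    using x(1) by (auto simp: FactGroup_def RCOSETS_def)
  ultimately show ?thesis unfolding conjugate_in_def by blast
qed

theorem proposition6p4:
  fixes G :: "('a, 'b) monoid_scheme" and S :: "'a set"
  assumes "free_group G"
    and "finite S" and "S \<subseteq> carrier G" and "generate G S = carrier G"
  shows "effectively_conjugacy_separable G S"
proof -
  obtain B where G: "group G" and B: "free_basis G B"
    using assms(1) by (auto simp: free_group_def)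
  interpret group G by fact
  have BG: "B \<subseteq> carrier G" using B by (simp add: free_basis_def)
  obtain c where c: "\<And>w. w \<in> words_over S \<Longrightarrow>
      \<exists>v \<in> words_over B. word_value G v = word_value G w \<and> length v \<le> c * length w"
    using rewrite_words_length[OF G B assms(2,3)] by blast
  have short: "\<exists>u \<in> words_over B. cyclically_reduced u \<and> length u \<le> c * word_length G S g \<and>
      conjugate_in G g (word_value G u)" if g: "g \<in> carrier G" for g
  proof -
    obtain w where w: "w \<in> words_over S" "word_value G w = g" "length w = word_length G S g"
      using shortest_word[OF G assms(3,4) g] by blast
    obtain v where "v \<in> words_over B" "word_value G v = g" "length v \<le> c * word_length G S g"
      using c[OF w(1)] w(2,3) by auto
    then show ?thesis
      using cyclically_reduced_conjugate[OF BG] by (meson order_trans)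
  qed
  define points where "points k = k * (2 * k + 1)" for k :: nat
  define \<Phi> where "\<Phi> k = points (c * k) ^ points (c * k)" for k
  have "computable \<Phi>"
    unfolding \<Phi>_def points_def
    by (intro computable_power computable_mult computable_add computable_const computable_ident)
  \<comment> \<open>The separating quotient is built from the longer of the two cyclically reduced words.\<close>
  have ordered: "\<exists>M. M \<lhd> G \<and> finite (carrier (G Mod M)) \<and>
      \<not> conjugate_in (G Mod M) (M #>\<^bsub>G\<^esub> g) (M #>\<^bsub>G\<^esub> h) \<and> order (G Mod M) \<le> \<Phi> k"
    if g: "g \<in> carrier G" and h: "h \<in> carrier G" and nc: "\<not> conjugate_in G g h"
      and u: "u \<in> words_over B" "cyclically_reduced u" "conjugate_in G g (word_value G u)"
      and w: "w \<in> words_over B" "conjugate_in G h (word_value G w)"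
      and len: "length w \<le> length u" "length u \<le> c * k" for g h u w k
  proof -
    let ?g = "word_value G u" and ?h = "word_value G w"
    have gh': "?g \<in> carrier G" "?h \<in> carrier G"
      using u w BG by (auto intro: word_value_closed words_over_mono)
    have nc': "\<not> conjugate_in G ?g ?h"
      using nc g h u(3) w(2) gh' by (meson conjugate_in_sym conjugate_in_trans)
    \<comment> \<open>If the longer word were empty, both elements would be trivial.\<close>
    have "u \<noteq> []"
    proof
      assume "u = []"
      then have "u = w" using len(1) by simp
      then show False using nc' gh'(1) conjugate_in_refl by simp
    qed
    from quotient_separating[OF G B u(1,2) this] obtain M where M: "M \<lhd> G"
      "finite (carrier (G Mod M))" "order (G Mod M) \<le> points (length u) ^ points (length u)"
      and sep: "conjugate_in (G Mod M) (M #>\<^bsub>G\<^esub> ?g) (M #>\<^bsub>G\<^esub> ?h) \<Longrightarrow> conjugate_in G ?g ?h"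
      using w(1) len(1) unfolding points_def by blast
    interpret M: normal M G by (rule M(1))
    interpret Q: group "G Mod M" by (rule M.factorgroup_is_group)
    have Q: "M #>\<^bsub>G\<^esub> x \<in> carrier (G Mod M)" if "x \<in> carrier G" for x
      using that by (auto simp: FactGroup_def RCOSETS_def)
    have "\<not> conjugate_in (G Mod M) (M #>\<^bsub>G\<^esub> g) (M #>\<^bsub>G\<^esub> h)"
    proof
      assume "conjugate_in (G Mod M) (M #>\<^bsub>G\<^esub> g) (M #>\<^bsub>G\<^esub> h)"
      moreover have "conjugate_in (G Mod M) (M #>\<^bsub>G\<^esub> g) (M #>\<^bsub>G\<^esub> ?g)" "conjugate_in (G Mod M) (M #>\<^bsub>G\<^esub> h) (M #>\<^bsub>G\<^esub> ?h)"
        using g h u(3) w(2) by (auto intro: M.conjugate_in_quotient)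
      ultimately have "conjugate_in (G Mod M) (M #>\<^bsub>G\<^esub> ?g) (M #>\<^bsub>G\<^esub> ?h)"
        using Q[OF g] Q[OF h] Q[OF gh'(1)] by (meson Q.conjugate_in_sym Q.conjugate_in_trans)
      then show False using sep nc' by blast
    qed
    moreover have "points (length u) ^ points (length u) \<le> \<Phi> k"
    proof -
      have le: "points (length u) \<le> points (c * k)"
        unfolding points_def using len(2) by (intro mult_le_mono) simp_all
      have pos: "points (length u) > 0" using \<open>u \<noteq> []\<close> by (simp add: points_def)
      have "points (length u) ^ points (length u) \<le> points (c * k) ^ points (length u)"
        using le by (rule power_mono) simp
      also have "\<dots> \<le> points (c * k) ^ points (c * k)"
        using le pos by (intro power_increasing) simp_all
      finally show ?thesis unfolding \<Phi>_def .
    qed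
    ultimately show ?thesis using M by (meson le_trans)
  qed
  have "\<exists>M. M \<lhd> G \<and> finite (carrier (G Mod M)) \<and> \<not> conjugate_in (G Mod M) (M #>\<^bsub>G\<^esub> g) (M #>\<^bsub>G\<^esub> h) \<and>
      order (G Mod M) \<le> \<Phi> (word_length G S g + word_length G S h)"
    if g: "g \<in> carrier G" and h: "h \<in> carrier G" and nc: "\<not> conjugate_in G g h" for g h
  proof -
    let ?k = "word_length G S g + word_length G S h"
    obtain u where u: "u \<in> words_over B" "cyclically_reduced u" "conjugate_in G g (word_value G u)"
      "length u \<le> c * word_length G S g" using short[OF g] by blast
    obtain w where w: "w \<in> words_over B" "cyclically_reduced w" "conjugate_in G h (word_value G w)"
      "length w \<le> c * word_length G S h" using short[OF h] by blast
    have len: "length u \<le> c * ?k" "length w \<le> c * ?k"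
      using u(4) w(4) by (simp_all add: distrib_left)
    show ?thesis
    proof (cases "length w \<le> length u")
      case True
      show ?thesis using ordered[OF g h nc u(1-3) w(1,3) True len(1)] .
    next
      case False
      have "\<not> conjugate_in G h g" using nc conjugate_in_sym[OF h] by blast
      moreover have "length u \<le> length w" using False by simp
      ultimately obtain M where M: "M \<lhd> G" "finite (carrier (G Mod M))"
        "\<not> conjugate_in (G Mod M) (M #>\<^bsub>G\<^esub> h) (M #>\<^bsub>G\<^esub> g)" "order (G Mod M) \<le> \<Phi> ?k"
        using ordered[OF h g _ w(1-3) u(1,3) _ len(2)] by blast
      interpret M: normal M G by (rule M(1))
      interpret Q: group "G Mod M" by (rule M.factorgroup_is_group)
      have "M #>\<^bsub>G\<^esub> g \<in> carrier (G Mod M)" using g by (auto simp: FactGroup_def RCOSETS_def)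
      then have "\<not> conjugate_in (G Mod M) (M #>\<^bsub>G\<^esub> g) (M #>\<^bsub>G\<^esub> h)"
        using M(3) Q.conjugate_in_sym by blast
      then show ?thesis using M by blast
    qed
  qed
  with \<open>computable \<Phi>\<close> show ?thesis
    unfolding effectively_conjugacy_separable_def by blast
qed

end
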